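(* Let $G$ be a finite bipartite graph. Then $\gamma(G)=\gamma_{\mathrm{m}}^{\infty}(G)=2$ if and only if $G\in\mathfrak{C}$, where $\mathfrak{C}$ is the class of all graphs obtained either from $K_{m,m}$, $m\geq 2$, by deleting (the edges of) a matching of size $k$, where $0\leq k\leq m$, or from $K_{m,n}$, $n>m\geq 2$, by deleting (the edges of) a matching of size $\ell$, where $0\leq \ell\leq m-1$.
   Context: All graphs are finite, simple and undirected. A dominating set of $G=(V,E)$ is a set $D\subseteq V$ such that every vertex of $V-D$ is adjacent to a vertex of $D$; $\gamma(G)$ is the minimum size of a dominating set. m-eternal domination ("all guards move"): a defender chooses a set $D_1\subseteq V$ and places one guard on each vertex of $D_1$. Then, for $i=1,2,\ldots$ in turn, an attacker (knowing the current position) chooses a vertex $r_i\in V-D_i$, and the defender responds with a set $D_{i+1}$ with $|D_{i+1}|=|D_i|$ and $r_i\in D_{i+1}$, obtained from $D_i$ by letting each guard either stay in place or move to an adjacent vertex (i.e. there is a bijection $f:D_i\to D_{i+1}$ with $f(v)=v$ or $f(v)$ adjacent to $v$ for each $v\in D_i$). Every $D_i$ must be a dominating set. $D_1$ is an m-eternal dominating set if the defender, starting from $D_1$, can respond in this way forever to every infinite sequence of attacks. $\gamma_{\mathrm{m}}^{\infty}(G)$ is the minimum size of an m-eternal dominating set of $G$.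
   Formalization: The graph of two isolated vertices and the graph of an isolated vertex plus a single edge are excluded: both have domination number and m-eternal domination number 2, but have fewer than 4 vertices and so are not in the class. *)

theory Defs
  imports "Graph_Theory.Kuratowski"
begin

(* A finite simple undirected graph is a pair_graph of Graph_Theory: a finite vertex set pverts G
   with a symmetric loop-free relation parcs G.  Each undirected edge {u,v} occurs in parcs G as
   the two arcs (u,v) and (v,u); edges G recovers the undirected edges. *)

definition edges :: "'a pair_pre_digraph \<Rightarrow> 'a set set" where
  "edges G = {{u, v} | u v. (u, v) \<in> parcs G}"

definition bipartite :: "'a pair_pre_digraph \<Rightarrow> bool" where
  "bipartite G \<longleftrightarrow>
     (\<exists>X Y. pverts G = X \<union> Y \<and> X \<inter> Y = {} \<and> parcs G \<subseteq> X \<times> Y \<union> Y \<times> X)"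

definition dominating_set :: "'a pair_pre_digraph \<Rightarrow> 'a set \<Rightarrow> bool" where
  "dominating_set G D \<longleftrightarrow>
     D \<subseteq> pverts G \<and> (\<forall>v \<in> pverts G - D. \<exists>u \<in> D. (u, v) \<in> parcs G)"

definition domination_number :: "'a pair_pre_digraph \<Rightarrow> nat" where
  "domination_number G = (LEAST k. \<exists>D. dominating_set G D \<and> card D = k)"

definition guards_move :: "'a pair_pre_digraph \<Rightarrow> 'a set \<Rightarrow> 'a set \<Rightarrow> bool" where
  "guards_move G D D' \<longleftrightarrow>
     (\<exists>f. bij_betw f D D' \<and> (\<forall>v \<in> D. f v = v \<or> (v, f v) \<in> parcs G))"

(* A defender's strategy s maps the list of the attacks made so far to the position of the guards,
   so that against the attacks r 0, r 1, ... the position faced by the attack r i is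
   s (map r [0..<i]).  The strategy is judged after every number n of legal attacks; thus plays in
   which no further legal attack exists (guards on all vertices) are covered as well, and the
   defender cannot profit from an illegal move that leaves no vertex to attack. *)

definition m_eternal_strategy :: "'a pair_pre_digraph \<Rightarrow> ('a list \<Rightarrow> 'a set) \<Rightarrow> bool" where
  "m_eternal_strategy G s \<longleftrightarrow>
     (\<forall>(r :: nat \<Rightarrow> 'a) n.
        (\<forall>i<n. r i \<in> pverts G - s (map r [0..<i])) \<longrightarrow>
        dominating_set G (s (map r [0..<n])) \<and>
        (\<forall>i<n. r i \<in> s (map r [0..<Suc i]) \<and>
               guards_move G (s (map r [0..<i])) (s (map r [0..<Suc i]))))"

definition m_eternal_dominating_set :: "'a pair_pre_digraph \<Rightarrow> 'a set \<Rightarrow> bool" where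
  "m_eternal_dominating_set G D \<longleftrightarrow> (\<exists>s. s [] = D \<and> m_eternal_strategy G s)"

definition m_eternal_domination_number :: "'a pair_pre_digraph \<Rightarrow> nat" where
  "m_eternal_domination_number G = (LEAST k. \<exists>D. m_eternal_dominating_set G D \<and> card D = k)"

definition matching :: "'a pair_pre_digraph \<Rightarrow> 'a set set \<Rightarrow> bool" where
  "matching G M \<longleftrightarrow> M \<subseteq> edges G \<and> pairwise disjnt M"

definition delete_edges :: "'a pair_pre_digraph \<Rightarrow> 'a set set \<Rightarrow> 'a pair_pre_digraph" where
  "delete_edges G M = G\<lparr>parcs := {(u, v) \<in> parcs G. {u, v} \<notin> M}\<rparr>"

(* K\<^bsub>m,n\<^esub> H says that H is some complete bipartite graph with parts of sizes m and n,
   hence the class is closed under isomorphism. *)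

definition class_C :: "'a pair_pre_digraph set" where
  "class_C =
     {delete_edges H M | H M m k.
        2 \<le> m \<and> k \<le> m \<and> K\<^bsub>m,m\<^esub> (with_proj H) \<and> matching H M \<and> card M = k} \<union>
     {delete_edges H M | H M m n l.
        2 \<le> m \<and> m < n \<and> l \<le> m - 1 \<and> K\<^bsub>m,n\<^esub> (with_proj H) \<and> matching H M \<and> card M = l}"

end

(* If two guards can defend G forever, every vertex lies in a dominating set of size 2, since the
   attacker may ask for it.  In a bipartite graph this alone forces every vertex to miss at most one
   vertex of the other part, so the missing edges form a matching.  If this matching covered a
   strictly smaller part, an unmatched vertex of the larger part would lie in no dominating pair.
   The excluded graphs arise when a part has at most one vertex.  Conversely, call x and y in opposite
   parts a good pair if each of them is adjacent to all other vertices of the opposite part.  In a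
   member of the class every vertex lies in a good pair, a good pair dominates, and the two guards
   can move from any good pair to any other one by changing sides. *)
theory Submission
  imports Defs
begin

section \<open>Bipartitions that miss few edges, and pairs of guards on opposite sides\<close>

definition parts :: "'a pair_pre_digraph \<Rightarrow> 'a set \<Rightarrow> 'a set \<Rightarrow> bool" where
  "parts G X Y \<longleftrightarrow> pverts G = X \<union> Y \<and> X \<inter> Y = {} \<and> parcs G \<subseteq> X \<times> Y \<union> Y \<times> X"

text \<open>Required in both directions, this makes the missing edges between the parts a
  matching.\<close>

definition almost_joined :: "'a pair_pre_digraph \<Rightarrow> 'a set \<Rightarrow> 'a set \<Rightarrow> bool" where
  "almost_joined G X Y \<longleftrightarrow>
     (\<forall>x\<in>X. \<forall>y\<in>Y. \<forall>y'\<in>Y. (x, y) \<notin> parcs G \<longrightarrow> (x, y') \<notin> parcs G \<longrightarrow> y = y')"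

text \<open>Nothing is required between \<open>x\<close> and \<open>y\<close> themselves: they may
  be adjacent or the ends of a missing edge.\<close>

definition good_pair :: "'a pair_pre_digraph \<Rightarrow> 'a set \<Rightarrow> 'a set \<Rightarrow> 'a \<Rightarrow> 'a \<Rightarrow> bool" where
  "good_pair G X Y x y \<longleftrightarrow> x \<in> X \<and> y \<in> Y \<and>
     (\<forall>y'\<in>Y - {y}. (x, y') \<in> parcs G) \<and> (\<forall>x'\<in>X - {x}. (x', y) \<in> parcs G)"

lemma parts_commute: "parts G X Y \<longleftrightarrow> parts G Y X"
  by (auto simp: parts_def)

lemma pair_graph_arc_sym:
  assumes "pair_graph G"
  shows "(u, v) \<in> parcs G \<longleftrightarrow> (v, u) \<in> parcs G"
proof -
  interpret pair_graph G by fact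
  show ?thesis using pair_sym_arcs by (auto simp: symmetric_def elim: symE)
qed

lemma pair_graph_finite_pverts:
  assumes "pair_graph G"
  shows "finite (pverts G)"
proof -
  interpret pair_graph G by fact
  show ?thesis by (rule pair_finite_verts)
qed


subsection \<open>The two domination numbers\<close>

lemma domination_number_le: "dominating_set G D \<Longrightarrow> domination_number G \<le> card D"
  unfolding domination_number_def by (rule Least_le) blast

lemma dominating_set_pverts: "dominating_set G (pverts G)"
  by (simp add: dominating_set_def)

lemma m_eternal_imp_dominating_set:
  assumes "m_eternal_dominating_set G D"
  shows "dominating_set G D"
proof -
  obtain s where "s [] = D" and s: "m_eternal_strategy G s"
    using assms by (auto simp: m_eternal_dominating_set_def)
  then show ?thesis
    using s[unfolded m_eternal_strategy_def, rule_format, of 0 undefined] by simp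
qed

text \<open>If \<open>v\<close> is unoccupied, one attack on it forces this position, and a
  bijection keeps the number of guards. Membership in the class is derived from this one-step
  consequence.\<close>

lemma m_eternal_attack:
  assumes "m_eternal_dominating_set G D" "v \<in> pverts G"
  shows "\<exists>D'. dominating_set G D' \<and> v \<in> D' \<and> card D' = card D"
proof (cases "v \<in> D")
  case True
  then show ?thesis using assms m_eternal_imp_dominating_set by blast
next
  case False
  obtain s where s0: "s [] = D" and s: "m_eternal_strategy G s"
    using assms(1) by (auto simp: m_eternal_dominating_set_def)
  have "dominating_set G (s [v]) \<and> v \<in> s [v] \<and> guards_move G D (s [v])"
    using s[unfolded m_eternal_strategy_def, rule_format, of "Suc 0" "\<lambda>_. v"] False assms(2)
    by (simp add: s0)
  then show ?thesis by (metis guards_move_def bij_betw_same_card)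
qed

text \<open>With guards everywhere no attack is legal. Hence the eternal number is a minimum over a
  nonempty set.\<close>

lemma m_eternal_pverts: "m_eternal_dominating_set G (pverts G)"
proof -
  have "m_eternal_strategy G (\<lambda>_. pverts G)"
    by (auto simp: m_eternal_strategy_def dominating_set_pverts)
  then show ?thesis by (auto simp: m_eternal_dominating_set_def)
qed

lemma m_eternal_domination_number_attained:
  "\<exists>D. m_eternal_dominating_set G D \<and> card D = m_eternal_domination_number G"
  unfolding m_eternal_domination_number_def
  by (rule LeastI_ex) (use m_eternal_pverts in blast)

text \<open>The defender needs no memory: each attack is answered by a fixed member of the family
  containing the attacked vertex, reachable from wherever the guards stand.\<close>

lemma m_eternal_if_mutually_reachable:
  assumes "D \<in> \<D>"
    and dom: "\<And>D. D \<in> \<D> \<Longrightarrow> dominating_set G D"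
    and move: "\<And>D D'. D \<in> \<D> \<Longrightarrow> D' \<in> \<D> \<Longrightarrow> guards_move G D D'"
    and cover: "\<And>v. v \<in> pverts G \<Longrightarrow> \<exists>D\<in>\<D>. v \<in> D"
  shows "m_eternal_dominating_set G D"
proof -
  obtain P where P: "\<And>v. v \<in> pverts G \<Longrightarrow> P v \<in> \<D> \<and> v \<in> P v"
    using cover by metis
  define s where "s rs = (if rs = [] then D else P (last rs))" for rs
  have "m_eternal_strategy G s"
    unfolding m_eternal_strategy_def
  proof (intro allI impI)
    fix r :: "nat \<Rightarrow> 'a" and n
    assume r: "\<forall>i<n. r i \<in> pverts G - s (map r [0..<i])"
    have s_Suc: "s (map r [0..<Suc i]) = P (r i)" for i
      by (simp add: s_def)
    have s_in: "s (map r [0..<i]) \<in> \<D>" if "i \<le> n" for i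
    proof (cases i)
      case 0
      then show ?thesis by (simp add: s_def assms(1))
    next
      case (Suc j)
      then show ?thesis using P r that s_Suc[of j] by auto
    qed
    have "r i \<in> s (map r [0..<Suc i])" if "i < n" for i
      unfolding s_Suc using P r that by blast
    moreover have "guards_move G (s (map r [0..<i])) (s (map r [0..<Suc i]))" if "i < n" for i
      using that by (intro move s_in) auto
    ultimately show "dominating_set G (s (map r [0..<n])) \<and>
        (\<forall>i<n. r i \<in> s (map r [0..<Suc i]) \<and>
               guards_move G (s (map r [0..<i])) (s (map r [0..<Suc i])))"
      using dom s_in by blast
  qed
  moreover have "s [] = D" by (simp add: s_def)
  ultimately show ?thesis by (auto simp: m_eternal_dominating_set_def)
qed


subsection \<open>The class as a condition on the parts\<close>

text \<open>\<open>G\<close> arises from the complete bipartite graph on its own parts by deleting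
  its missing edges, a matching by the two one-sided conditions. If the parts differ in size,
  \<open>full\<close> provides a vertex of the smaller part outside the matching.\<close>

lemma class_C_I:
  assumes G: "pair_graph G" and parts: "parts G X Y"
    and cX: "2 \<le> card X" and cXY: "card X \<le> card Y"
    and XY: "almost_joined G X Y" and YX: "almost_joined G Y X"
    and full: "card X < card Y \<Longrightarrow> \<exists>x\<in>X. \<forall>y\<in>Y. (x, y) \<in> parcs G"
  shows "G \<in> class_C"
proof -
  note sym = pair_graph_arc_sym[OF G]
  have fin: "finite (X \<union> Y)"
    using pair_graph_finite_pverts[OF G] parts by (simp add: parts_def)
  define H where "H = \<lparr>pverts = X \<union> Y, parcs = X \<times> Y \<union> Y \<times> X\<rparr>"
  define R where "R = {(x, y). x \<in> X \<and> y \<in> Y \<and> (x, y) \<notin> parcs G}"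
  define M where "M = (\<lambda>(x, y). {x, y}) ` R"
  have disj: "X \<inter> Y = {}" using parts by (simp add: parts_def)
  have K: "K\<^bsub>card X,card Y\<^esub> (with_proj H)"
    unfolding complete_bipartite_digraph_pair_def H_def using fin disj by auto
  have M_iff: "{u, v} \<in> M \<longleftrightarrow> (u, v) \<notin> parcs G" if "u \<in> X" "v \<in> Y" for u v
    using that disj by (auto simp: M_def R_def doubleton_eq_iff image_iff)
  have "parcs G = {(u, v) \<in> parcs H. {u, v} \<notin> M}"
  proof (rule set_eqI, clarify)
    fix u v
    have "(u, v) \<in> X \<times> Y \<union> Y \<times> X" if "(u, v) \<in> parcs G"
      using that parts by (auto simp: parts_def)
    moreover have "{u, v} \<in> M \<longleftrightarrow> (u, v) \<notin> parcs G" if "(u, v) \<in> X \<times> Y \<union> Y \<times> X"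
      using that M_iff[of u v] M_iff[of v u] sym[of u v] by (metis insert_commute Un_iff mem_Sigma_iff)
    ultimately show "(u, v) \<in> parcs G \<longleftrightarrow> (u, v) \<in> {(u, v) \<in> parcs H. {u, v} \<notin> M}"
      by (auto simp: H_def)
  qed
  then have GH: "G = delete_edges H M"
    using parts by (simp add: delete_edges_def H_def parts_def)
  have "M \<subseteq> edges H"
    by (auto simp: M_def R_def edges_def H_def)
  moreover have "pairwise disjnt M"
  proof (rule pairwiseI)
    fix e e' assume "e \<in> M" "e' \<in> M" "e \<noteq> e'"
    then obtain x y x' y' where
      e: "x \<in> X" "y \<in> Y" "(x, y) \<notin> parcs G" "e = {x, y}"
      and e': "x' \<in> X" "y' \<in> Y" "(x', y') \<notin> parcs G" "e' = {x', y'}"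
      by (auto simp: M_def R_def)
    have "x = x' \<longleftrightarrow> y = y'"
      using e e' XY YX sym unfolding almost_joined_def by metis
    moreover have "x \<noteq> y'" "x' \<noteq> y" using e e' disj by blast+
    ultimately show "disjnt e e'"
      using \<open>e \<noteq> e'\<close> e(4) e'(4) by (auto simp: disjnt_def)
  qed
  ultimately have "matching H M" by (simp add: matching_def)
  \<comment> \<open>A vertex of \<open>X\<close> lies on at most one missing edge, so the matching
    can be counted by its ends in \<open>X\<close>.\<close>
  have "inj_on fst R"
    using XY by (auto simp: inj_on_def R_def almost_joined_def)
  moreover have fin_R: "finite R"
    by (rule finite_subset[of _ "X \<times> Y"]) (use fin in \<open>auto simp: R_def\<close>)
  ultimately have card_M: "card M \<le> card (fst ` R)"
    unfolding M_def using card_image_le card_image by metis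
  have "fst ` R \<subseteq> X" by (auto simp: R_def)
  show ?thesis
  proof (cases "card X = card Y")
    case True
    have "card M \<le> card X"
      using card_M card_mono[of X "fst ` R"] \<open>fst ` R \<subseteq> X\<close> fin by simp
    then show ?thesis
      unfolding class_C_def using True GH K \<open>matching H M\<close> cX by auto
  next
    case False
    then obtain x where "x \<in> X" "\<forall>y\<in>Y. (x, y) \<in> parcs G"
      using full cXY by auto
    then have "fst ` R \<subseteq> X - {x}" by (auto simp: R_def)
    then have "card M \<le> card X - 1"
      using card_M card_mono[of "X - {x}" "fst ` R"] \<open>x \<in> X\<close> fin by simp
    then show ?thesis
      unfolding class_C_def using False cXY GH K \<open>matching H M\<close> cX by fastforce
  qed
qed

text \<open>Both families are treated at once with \<open>m \<le> n\<close>, the bound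
  \<open>m - 1\<close> being guarded by \<open>m < n\<close>.\<close>

lemma class_C_E:
  assumes "G \<in> class_C"
  obtains X Y where "finite X" "finite Y" "parts G X Y" "2 \<le> card X" "card X \<le> card Y"
    "almost_joined G X Y" "almost_joined G Y X"
    "card X < card Y \<Longrightarrow> \<exists>x\<in>X. \<forall>y\<in>Y. (x, y) \<in> parcs G"
proof -
  obtain H M m n where "2 \<le> m" "m \<le> n" and K: "K\<^bsub>m,n\<^esub> (with_proj H)" and M: "matching H M"
    and small: "m < n \<Longrightarrow> card M \<le> m - 1" and GH: "G = delete_edges H M"
  proof -
    consider H M m where "2 \<le> m" "K\<^bsub>m,m\<^esub> (with_proj H)" "matching H M" "G = delete_edges H M"
      | H M m n where "2 \<le> m" "m < n" "K\<^bsub>m,n\<^esub> (with_proj H)" "matching H M" "card M \<le> m - 1"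
          "G = delete_edges H M"
      using assms unfolding class_C_def by blast
    then show thesis
    proof cases
      case 1
      then show ?thesis by (intro that[of m m]) simp_all
    next
      case 2
      then show ?thesis by (intro that[of m n]) simp_all
    qed
  qed
  obtain X Y where fin: "finite (pverts H)" and H: "pverts H = X \<union> Y" "X \<inter> Y = {}"
      "parcs H = X \<times> Y \<union> Y \<times> X" and card: "card X = m" "card Y = n"
    using K[unfolded complete_bipartite_digraph_pair_def] by blast
  have arc: "(u, v) \<in> parcs G \<longleftrightarrow> (u, v) \<in> X \<times> Y \<union> Y \<times> X \<and> {u, v} \<notin> M" for u v
    by (simp add: GH H delete_edges_def)
  have "parts G X Y"
    using H by (auto simp: GH parts_def delete_edges_def)
  have disj: "e = e'" if "e \<in> M" "e' \<in> M" "u \<in> e" "u \<in> e'" for e e' u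
    using M that by (auto simp: matching_def pairwise_def disjnt_def)
  have "y = y'" if "{x, y} \<in> M" "{x, y'} \<in> M" for x y y'
    using disj[OF that, of x] by (auto simp: doubleton_eq_iff)
  then have "almost_joined G X Y" "almost_joined G Y X"
    unfolding almost_joined_def arc by blast+
  moreover have "\<exists>x\<in>X. \<forall>y\<in>Y. (x, y) \<in> parcs G" if "card X < card Y"
  proof (rule ccontr)
    assume "\<not> ?thesis"
    then have "\<forall>x\<in>X. \<exists>y\<in>Y. {x, y} \<in> M" unfolding arc by blast
    \<comment> \<open>The edges \<open>{x, g x}\<close> are \<open>m\<close> distinct members of
      \<open>M\<close>, more than \<open>m - 1\<close> as \<open>m\<close> is positive.\<close>
    then obtain g where g: "\<And>x. x \<in> X \<Longrightarrow> g x \<in> Y \<and> {x, g x} \<in> M" by metis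
    have "inj_on (\<lambda>x. {x, g x}) X"
      using g H(2) by (auto simp: inj_on_def doubleton_eq_iff)
    moreover have "(\<lambda>x. {x, g x}) ` X \<subseteq> M" using g by auto
    moreover have "finite M"
    proof (rule finite_subset)
      show "M \<subseteq> Pow (pverts H)"
        using M H by (auto simp: matching_def edges_def)
    qed (simp add: fin)
    ultimately have "card X \<le> card M" by (metis card_inj_on_le)
    then show False using small that card \<open>2 \<le> m\<close> by simp
  qed
  ultimately show thesis
    using fin H(1) \<open>parts G X Y\<close> card \<open>2 \<le> m\<close> \<open>m \<le> n\<close>
    by (intro that[of X Y]) simp_all
qed


subsection \<open>Defending with good pairs\<close>

lemma good_pair_dominating_set:
  assumes "pair_graph G" "parts G X Y" "good_pair G X Y x y"
  shows "dominating_set G {x, y}"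
  using assms(2,3) pair_graph_arc_sym[OF assms(1)]
  by (auto simp: dominating_set_def parts_def good_pair_def)

lemma good_pair_guards_move:
  assumes "pair_graph G" "parts G X Y" "good_pair G X Y x y" "good_pair G X Y x' y'"
  shows "guards_move G {x, y} {x', y'}"
proof (cases "x = x' \<and> y = y'")
  case True
  then show ?thesis unfolding guards_move_def by (auto intro!: exI[of _ id])
next
  case False
  define f where "f v = (if v = x then y' else x')" for v
  have ne: "x \<noteq> y" "x' \<noteq> y'"
    using assms(2-4) by (auto simp: parts_def good_pair_def)
  then have "bij_betw f {x, y} {x', y'}"
    by (auto simp: bij_betw_def inj_on_def f_def)
  \<comment> \<open>If \<open>y \<noteq> y'\<close>, the first pair gives \<open>(x, y')\<close> and
    the second \<open>(x', y)\<close>; if \<open>x \<noteq> x'\<close>, the two pairs exchange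
    roles.\<close>
  moreover have "(x, y') \<in> parcs G" "(x', y) \<in> parcs G"
    using False assms(3,4) unfolding good_pair_def by blast+
  ultimately show ?thesis
    unfolding guards_move_def
    using pair_graph_arc_sym[OF assms(1), of x' y] ne by (auto simp: f_def intro!: exI[of _ f])
qed

text \<open>A missing edge at \<open>x\<close> supplies the partner, since neither of its ends
  misses anything else. If \<open>x\<close> misses nothing, its partner must miss nothing either,
  whence \<open>ex\<close>.\<close>

lemma ex_good_pair:
  assumes G: "pair_graph G" and "x \<in> X"
    and XY: "almost_joined G X Y" and YX: "almost_joined G Y X"
    and ex: "(\<forall>y\<in>Y. (x, y) \<in> parcs G) \<Longrightarrow> \<exists>y\<in>Y. \<forall>x'\<in>X. (x', y) \<in> parcs G"
  shows "\<exists>y. good_pair G X Y x y"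
proof (cases "\<forall>y\<in>Y. (x, y) \<in> parcs G")
  case True
  then show ?thesis using ex \<open>x \<in> X\<close> by (auto simp: good_pair_def)
next
  case False
  then obtain y where "y \<in> Y" "(x, y) \<notin> parcs G" by blast
  then have "good_pair G X Y x y"
    using XY YX \<open>x \<in> X\<close> pair_graph_arc_sym[OF G]
    unfolding good_pair_def almost_joined_def by blast
  then show ?thesis ..
qed

lemma good_pair_commute:
  assumes "pair_graph G"
  shows "good_pair G X Y x y \<longleftrightarrow> good_pair G Y X y x"
  using pair_graph_arc_sym[OF assms] unfolding good_pair_def by blast

(* Otherwise the non-neighbours give an injection of X into Y that misses y. *)
lemma ex_full_vertex:
  assumes G: "pair_graph G" and fin: "finite Y" and card: "card Y \<le> card X"
    and XY: "almost_joined G X Y" and YX: "almost_joined G Y X"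
    and y: "y \<in> Y" "\<forall>x\<in>X. (x, y) \<in> parcs G"
  shows "\<exists>x\<in>X. \<forall>y\<in>Y. (x, y) \<in> parcs G"
proof (rule ccontr)
  assume "\<not> ?thesis"
  then obtain g where g: "\<And>x. x \<in> X \<Longrightarrow> g x \<in> Y \<and> (x, g x) \<notin> parcs G" by metis
  have "inj_on g X"
    using g YX pair_graph_arc_sym[OF G] unfolding inj_on_def almost_joined_def by metis
  moreover have "g ` X \<subseteq> Y - {y}" using g y by auto
  ultimately have "card X \<le> card (Y - {y})" using fin by (metis card_inj_on_le finite_Diff)
  moreover have "card (Y - {y}) < card Y"
    using fin y by (intro psubset_card_mono) auto
  ultimately show False using card by simp
qed

lemma class_C_domination_numbers:
  assumes G: "pair_graph G" and "G \<in> class_C"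
  shows "domination_number G = 2" "m_eternal_domination_number G = 2"
proof -
  obtain X Y where fin: "finite X" "finite Y" and parts: "parts G X Y"
    and card: "2 \<le> card X" "card X \<le> card Y"
    and XY: "almost_joined G X Y" and YX: "almost_joined G Y X"
    and full: "card X < card Y \<Longrightarrow> \<exists>x\<in>X. \<forall>y\<in>Y. (x, y) \<in> parcs G"
    using class_C_E[OF assms(2)] by blast
  note sym = pair_graph_arc_sym[OF G]
  define \<D> where "\<D> = {{x, y} | x y. good_pair G X Y x y}"
  have fullX: "\<exists>y\<in>Y. \<forall>x'\<in>X. (x', y) \<in> parcs G"
    if "x \<in> X" "\<forall>y\<in>Y. (x, y) \<in> parcs G" for x
    using ex_full_vertex[OF G fin(1) card(2) YX XY that(1)] that sym by blast
  \<comment> \<open>If \<open>Y\<close> is strictly larger, counting non-neighbours gives nothing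
    and the bound on the matching, in the form of \<open>full\<close>, takes over. For equal sizes
    counting works as for \<open>fullX\<close>.\<close>
  have fullY: "\<exists>x\<in>X. \<forall>y'\<in>Y. (y', x) \<in> parcs G"
    if "y \<in> Y" "\<forall>x\<in>X. (y, x) \<in> parcs G" for y
  proof (cases "card X < card Y")
    case True
    then show ?thesis using full sym by blast
  next
    case False
    then show ?thesis
      using ex_full_vertex[OF G fin(2) _ XY YX that(1)] that sym card(2) by auto
  qed
  have cover: "\<exists>D\<in>\<D>. v \<in> D" if "v \<in> pverts G" for v
  proof (cases "v \<in> X")
    case True
    then obtain y where "good_pair G X Y v y"
      using ex_good_pair[OF G True XY YX] fullX by blast
    then show ?thesis by (auto simp: \<D>_def)
  next
    case False
    then have "v \<in> Y" using that parts by (simp add: parts_def)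
    then obtain x where "good_pair G Y X v x"
      using ex_good_pair[OF G \<open>v \<in> Y\<close> YX XY] fullY by blast
    then show ?thesis by (auto simp: \<D>_def good_pair_commute[OF G, of Y])
  qed
  have dom: "dominating_set G D" if "D \<in> \<D>" for D
    using that good_pair_dominating_set[OF G parts] by (auto simp: \<D>_def)
  obtain v where "v \<in> X" using card by fastforce
  then obtain D where D: "D \<in> \<D>" using cover[of v] parts by (auto simp: parts_def)
  have "m_eternal_dominating_set G D"
  proof (rule m_eternal_if_mutually_reachable[OF D dom _ cover])
    show "guards_move G D D'" if "D \<in> \<D>" "D' \<in> \<D>" for D D'
      using that good_pair_guards_move[OF G parts] unfolding \<D>_def by blast
  qed
  have "card D = 2"
  proof -
    obtain x y where "D = {x, y}" "x \<in> X" "y \<in> Y"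
      using D by (auto simp: \<D>_def good_pair_def)
    moreover have "x \<noteq> y" using calculation parts by (auto simp: parts_def)
    ultimately show ?thesis by simp
  qed
  \<comment> \<open>A single guard covers no other vertex of its own part, and both parts have at
    least two vertices.\<close>
  have lower: "2 \<le> card D'" if "dominating_set G D'" for D'
  proof (rule ccontr)
    assume "\<not> 2 \<le> card D'"
    have "finite D'"
      using that fin parts by (auto simp: dominating_set_def parts_def intro: finite_subset)
    \<comment> \<open>This includes an empty \<open>D'\<close>, so \<open>u\<close> is not yet known
      to be a vertex.\<close>
    then obtain u where "D' \<subseteq> {u}"
      using \<open>\<not> 2 \<le> card D'\<close> card_le_Suc0_iff_eq[of D'] by (cases "D' = {}") auto
    have dom_u: "(u, w) \<in> parcs G" if "w \<in> pverts G" "w \<noteq> u" for w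
      using \<open>dominating_set G D'\<close> \<open>D' \<subseteq> {u}\<close> that unfolding dominating_set_def by blast
    have False if "u \<in> Z" "2 \<le> card Z" "parts G Z Z'" for Z Z'
    proof -
      have "\<not> Z \<subseteq> {u}" using that(2) card_mono[of "{u}" Z] by auto
      then obtain w where "w \<in> Z" "w \<noteq> u" by blast
      then show False using dom_u[of w] that(1,3) by (auto simp: parts_def)
    qed
    moreover have "u \<in> X \<union> Y"
      using dom_u \<open>v \<in> X\<close> parts unfolding parts_def by blast
    ultimately show False
      using parts card by (meson Un_iff order_trans parts_commute)
  qed
  show "domination_number G = 2"
    unfolding domination_number_def
    by (rule Least_equality) (use dom[OF D] \<open>card D = 2\<close> lower in blast)+
  show "m_eternal_domination_number G = 2"
    unfolding m_eternal_domination_number_def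
    by (rule Least_equality)
      (use \<open>m_eternal_dominating_set G D\<close> \<open>card D = 2\<close> lower m_eternal_imp_dominating_set in blast)+
qed


subsection \<open>Graphs covered by dominating pairs\<close>

lemma dominating_pairD:
  assumes "dominating_set G {u, v}" "w \<in> pverts G"
  shows "w = u \<or> w = v \<or> (u, w) \<in> parcs G \<or> (v, w) \<in> parcs G"
  using assms by (auto simp: dominating_set_def)

lemma dominating_pair_other_part:
  assumes "parts G X Y" "dominating_set G {u, v}" "u \<in> X" "w \<in> Y"
  shows "w = v \<or> (u, w) \<in> parcs G \<or> v \<in> X \<and> (v, w) \<in> parcs G"
  using dominating_pairD[OF assms(2), of w] assms(1,3,4) by (auto simp: parts_def)

text \<open>A guard covers no other vertex of its own part, so these fall to the second guard
  alone.\<close>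

lemma dominating_pair_same_part:
  assumes "parts G X Y" "dominating_set G {u, v}" "u \<in> X" "w \<in> X"
  shows "w = u \<or> w = v \<or> v \<in> Y \<and> (v, w) \<in> parcs G"
  using dominating_pairD[OF assms(2), of w] assms(1,3,4) by (auto simp: parts_def)

text \<open>Suppose \<open>x\<close> misses \<open>y\<close> and \<open>y'\<close>, and let
  \<open>{y, u}\<close> dominate. Then \<open>u\<close> has to cover both \<open>x\<close> and
  \<open>y'\<close>: in \<open>X\<close> it must be \<open>x\<close>, which misses
  \<open>y'\<close>; in \<open>Y\<close> it must be \<open>y'\<close>, which misses
  \<open>x\<close>.\<close>

lemma almost_joined_if_dominating_pairs:
  assumes G: "pair_graph G" and parts: "parts G X Y"
    and pair: "\<And>v. v \<in> pverts G \<Longrightarrow> \<exists>w. dominating_set G {v, w}"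
  shows "almost_joined G X Y"
  unfolding almost_joined_def
proof (intro ballI impI, rule ccontr)
  fix x y y'
  assume x: "x \<in> X" and y: "y \<in> Y" "(x, y) \<notin> parcs G"
    and y': "y' \<in> Y" "(x, y') \<notin> parcs G" and "y \<noteq> y'"
  note sym = pair_graph_arc_sym[OF G]
  have parts': "parts G Y X" using parts parts_commute by blast
  obtain u where u: "dominating_set G {y, u}"
    using pair[of y] y(1) parts unfolding parts_def by blast
  have "x = u \<or> u \<in> Y \<and> (u, x) \<in> parcs G"
    using dominating_pair_other_part[OF parts' u y(1) x] y(2) sym[of x y] by blast
  moreover have "y' = u \<or> u \<in> X \<and> (u, y') \<in> parcs G"
    using dominating_pair_same_part[OF parts' u y(1) y'(1)] \<open>y \<noteq> y'\<close> by blast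
  moreover have "X \<inter> Y = {}" using parts by (simp add: parts_def)
  ultimately show False using y'(2) sym[of x y'] x y'(1) by blast
qed

text \<open>If the smaller part \<open>X\<close> has at most one vertex, only the two excluded
  graphs remain. Otherwise the one thing left to find is the vertex that \<open>class_C_I\<close>
  asks for when the sizes differ.\<close>

lemma class_C_if_dominating_pairs:
  assumes G: "pair_graph G" and parts: "parts G X Y" and le: "card X \<le> card Y"
    and pair: "\<And>v. v \<in> pverts G \<Longrightarrow> \<exists>w. w \<noteq> v \<and> dominating_set G {v, w}"
    and lower: "\<And>v. \<not> dominating_set G {v}" and ne: "pverts G \<noteq> {}"
    and exc: "\<not> (card (pverts G) = 2 \<and> card (edges G) = 0)"
      "\<not> (card (pverts G) = 3 \<and> card (edges G) = 1)"
  shows "G \<in> class_C"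
proof -
  note sym = pair_graph_arc_sym[OF G]
  have parts': "parts G Y X" using parts parts_commute by blast
  have fin: "finite X" "finite Y"
    using pair_graph_finite_pverts[OF G] parts by (simp_all add: parts_def)
  have XY: "almost_joined G X Y"
    using almost_joined_if_dominating_pairs[OF G parts] pair by blast
  have YX: "almost_joined G Y X"
    using almost_joined_if_dominating_pairs[OF G parts'] pair by blast
  consider "card X = 0" | "card X = 1" | "2 \<le> card X" by linarith
  then show ?thesis
  proof cases
    case 1
    then have "X = {}" using fin by simp
    then have "parcs G = {}" using parts by (auto simp: parts_def)
    obtain v where v: "v \<in> pverts G" using ne by blast
    then obtain w where "w \<noteq> v" "dominating_set G {v, w}" using pair by blast
    then have "pverts G = {v, w}"
      using \<open>parcs G = {}\<close> by (auto simp: dominating_set_def)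
    moreover have "edges G = {}" using \<open>parcs G = {}\<close> by (auto simp: edges_def)
    ultimately show ?thesis using exc(1) \<open>w \<noteq> v\<close> by simp
  next
    case 2
    then obtain x where X: "X = {x}" by (auto simp: card_1_singleton_iff)
    obtain y0 where y0: "y0 \<in> Y" "(x, y0) \<notin> parcs G"
      using lower[of x] X parts by (auto simp: dominating_set_def parts_def)
    have "x \<noteq> y0" using X y0 parts by (auto simp: parts_def)
    show ?thesis
    proof (cases "Y = {y0}")
      case True
      then have "pverts G = {x, y0}" using X parts by (auto simp: parts_def)
      moreover have "parcs G = {}"
        using True X parts y0 sym by (auto simp: parts_def)
      then have "edges G = {}" by (auto simp: edges_def)
      ultimately show ?thesis using exc(1) \<open>x \<noteq> y0\<close> by simp
    next
      case False
      then obtain y1 where y1: "y1 \<in> Y" "y1 \<noteq> y0" using y0 by blast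
      then have "x \<noteq> y1" using X parts by (auto simp: parts_def)
      obtain w where w: "dominating_set G {y1, w}"
        using pair[of y1] y1 parts by (auto simp: parts_def)
      (* y0 is isolated. *)
      then have "w = y0"
        using dominating_pairD[OF w, of y0] y0 y1 X parts by (auto simp: parts_def)
      \<comment> \<open>Both guards stand in \<open>Y\<close>, so they cover no further vertex of
        \<open>Y\<close>; then \<open>x\<close> must be covered by \<open>y1\<close>, and
        \<open>G\<close> is an edge plus an isolated vertex.\<close>
      then have "z \<in> {y0, y1}" if "z \<in> Y" for z
        using dominating_pairD[OF w, of z] that y0 y1 X parts by (auto simp: parts_def)
      then have Y: "Y = {y0, y1}" using y0 y1 by blast
      have "(y1, x) \<in> parcs G"
        using dominating_pairD[OF w, of x] \<open>w = y0\<close> \<open>x \<noteq> y0\<close> \<open>x \<noteq> y1\<close> X parts y0 sym[of x y0]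
        by (auto simp: parts_def)
      then have "(x, y1) \<in> parcs G" "(y0, x) \<notin> parcs G"
        using sym[of x] y0 by auto
      moreover have "parcs G \<subseteq> {x} \<times> {y0, y1} \<union> {y0, y1} \<times> {x}"
        using X Y parts by (simp add: parts_def)
      ultimately have "parcs G = {(x, y1), (y1, x)}"
        using \<open>(y1, x) \<in> parcs G\<close> y0 by auto
      then have "edges G = {{x, y1}}" by (auto simp: edges_def)
      moreover have "pverts G = {x, y0, y1}" using X Y parts by (auto simp: parts_def)
      ultimately show ?thesis
        using exc(2) \<open>x \<noteq> y0\<close> \<open>x \<noteq> y1\<close> y1 by simp
    qed
  next
    case 3
    have "\<exists>x\<in>X. \<forall>y\<in>Y. (x, y) \<in> parcs G" if "card X < card Y"
    proof (rule ccontr)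
      assume "\<not> ?thesis"
      then obtain g where g: "\<And>x. x \<in> X \<Longrightarrow> g x \<in> Y \<and> (x, g x) \<notin> parcs G" by metis
      have "card (g ` X) < card Y" using that card_image_le[of X g] fin by simp
      \<comment> \<open>As \<open>g\<close> takes fewer values than \<open>Y\<close> has vertices,
        some \<open>y\<close> is not hit. If its partner \<open>u\<close> lies in \<open>X\<close>,
        then \<open>g u\<close> is left uncovered.\<close>
      then obtain y where y: "y \<in> Y" "y \<notin> g ` X"
        by (metis card_mono fin(1) finite_imageI not_le subsetI)
      then obtain u where u: "u \<noteq> y" "dominating_set G {y, u}"
        using pair[of y] parts by (auto simp: parts_def)
      show False
      proof (cases "u \<in> X")
        case True
        then have "g u \<noteq> y" using y(2) by blast
        moreover have "u \<notin> Y" using True parts by (auto simp: parts_def)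
        ultimately show False
          using dominating_pair_same_part[OF parts' u(2) y(1), of "g u"] g[OF True] by metis
      next
        case False
        \<comment> \<open>Two guards in \<open>Y\<close> cover nothing else there, but
          \<open>Y\<close> has at least three vertices.\<close>
        then have "Y \<subseteq> {y, u}"
          using dominating_pair_same_part[OF parts' u(2) y(1)] by blast
        then have "card Y \<le> 2" using card_mono[of "{y, u}" Y] u(1) by simp
        then show False using that 3 by simp
      qed
    qed
    then show ?thesis using class_C_I[OF G parts 3 le XY YX] by blast
  qed
qed

text \<open>The excluded graphs, two isolated vertices and an edge plus an isolated vertex, have
  both numbers equal to 2, while members of the class have at least four vertices.\<close>

theorem theorem4p3:
  fixes G :: "'a pair_pre_digraph"
  assumes "pair_graph G"
    and "bipartite G"
    and "\<not> (card (pverts G) = 2 \<and> card (edges G) = 0)"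
    and "\<not> (card (pverts G) = 3 \<and> card (edges G) = 1)"
  shows "(domination_number G = 2 \<and> m_eternal_domination_number G = 2) \<longleftrightarrow> G \<in> class_C"
proof
  assume two: "domination_number G = 2 \<and> m_eternal_domination_number G = 2"
  then have no_small: "\<not> dominating_set G D" if "card D < 2" for D
    using domination_number_le[of G D] that by fastforce
  have lower: "\<not> dominating_set G {v}" for v by (rule no_small) simp
  have ne: "pverts G \<noteq> {}"
    using dominating_set_pverts[of G] no_small[of "{}"] by auto
  obtain D where D: "m_eternal_dominating_set G D" "card D = 2"
    using m_eternal_domination_number_attained[of G] two by auto
  have pair: "\<exists>w. w \<noteq> v \<and> dominating_set G {v, w}" if v: "v \<in> pverts G" for v
  proof -
    obtain D' where D': "dominating_set G D'" "v \<in> D'" "card D' = 2"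
      using m_eternal_attack[OF D(1) v] D(2) by auto
    obtain a b where "D' = {a, b}" "a \<noteq> b"
      using D'(3) by (auto simp: card_2_iff)
    then show ?thesis using D'(1,2) by (metis insertE insert_commute singletonD)
  qed
  obtain X Y where XY: "parts G X Y"
    using assms(2) by (auto simp: bipartite_def parts_def)
  show "G \<in> class_C"
  proof (cases "card X \<le> card Y")
    case True
    show ?thesis
      using class_C_if_dominating_pairs[OF assms(1) XY True pair lower ne assms(3,4)] by blast
  next
    case False
    then have "card Y \<le> card X" by simp
    then show ?thesis
      using class_C_if_dominating_pairs[OF assms(1) _ _ pair lower ne assms(3,4)] XY
      by (metis parts_commute)
  qed
next
  assume "G \<in> class_C"
  then show "domination_number G = 2 \<and> m_eternal_domination_number G = 2"
    using class_C_domination_numbers[OF assms(1)] by blast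
qed

end
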